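(* Let $\mathcal F$ be an equidistant foliation of $\mathbb R^n$ and let $F$ be a regular leaf. If $F$ is not full, then the minimal affine subspace $V$ of $\mathbb R^n$ containing $F$ consists of leaves of $\mathcal F$, i.e. all leaves intersecting $V$ are contained in $V$.
   Context: An equidistant foliation of $\mathbb R^n$ is a partition $\mathcal F$ of $\mathbb R^n$ into complete, smooth, connected, properly embedded submanifolds (leaves, possibly of different dimensions) such that for any two leaves $F,G\in\mathcal F$ and $p\in F$ the distance $\operatorname{dist}(p,G)$ does not depend on the choice of $p\in F$, and such that any vector tangent to a leaf can be locally extended to a smooth vector field everywhere tangent to the leaves. The space of leaves $\mathbb B=\mathbb R^n/\mathcal F$ with $d_{\mathbb B}(F,G)=\operatorname{dist}(F,G)$ is an Alexandrov space; a point of $\mathbb B$ is regular if its tangent cone is isometric to Euclidean space of dimension $\dim\mathbb B$, and a leaf is regular if it is a regular point of $\mathbb B$. A submanifold of $\mathbb R^n$ is full if it is not contained in any proper affine subspace. *)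

theory Defs
  imports "HOL-Analysis.Analysis"
begin

subsection \<open>Smooth maps and submanifolds\<close>

text \<open>Intended for open \<open>S\<close>; the partial maps \<open>x \<mapsto> Df(x) v\<close> play the role of
  iterated partial derivatives.\<close>

primrec Ck_on :: "nat \<Rightarrow> ('a::euclidean_space \<Rightarrow> 'b::real_normed_vector) \<Rightarrow> 'a set \<Rightarrow> bool" where
  "Ck_on 0 f S \<longleftrightarrow> continuous_on S f"
| "Ck_on (Suc k) f S \<longleftrightarrow> (\<forall>x\<in>S. f differentiable (at x)) \<and>
     (\<forall>v. Ck_on k (\<lambda>x. frechet_derivative f (at x) v) S)"

definition smooth_on :: "('a::euclidean_space \<Rightarrow> 'b::real_normed_vector) \<Rightarrow> 'a set \<Rightarrow> bool" where
  "smooth_on f S \<longleftrightarrow> (\<forall>k. Ck_on k f S)"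

definition embedded_submanifold :: "nat \<Rightarrow> 'a::euclidean_space set \<Rightarrow> bool" where
  "embedded_submanifold k M \<longleftrightarrow>
     (\<forall>p\<in>M. \<exists>U V \<phi> \<psi> L. open U \<and> p \<in> U \<and> open (V :: 'a set) \<and>
        homeomorphism U V \<phi> \<psi> \<and> smooth_on \<phi> U \<and> smooth_on \<psi> V \<and>
        subspace L \<and> dim L = k \<and> \<phi> ` (U \<inter> M) = V \<inter> L)"

definition properly_embedded_submanifold :: "nat \<Rightarrow> 'a::euclidean_space set \<Rightarrow> bool" where
  "properly_embedded_submanifold k M \<longleftrightarrow>
     embedded_submanifold k M \<and>
     proper_map (top_of_set M) euclidean (\<lambda>x. x)"

text \<open>Velocities of smooth curves in \<open>M\<close> through \<open>p\<close>.\<close>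

definition tangent_space :: "'a::euclidean_space set \<Rightarrow> 'a \<Rightarrow> 'a set" where
  "tangent_space M p =
     {v. \<exists>\<gamma> e. 0 < e \<and> smooth_on \<gamma> {-e<..<e} \<and> \<gamma> ` {-e<..<e} \<subseteq> M \<and> \<gamma> (0::real) = p \<and>
         (\<gamma> has_vector_derivative v) (at 0)}"

text \<open>The Riemannian distance of the induced metric. A piecewise \<open>C\<^sup>1\<close> path in the sense of
  \<^const>\<open>valid_path\<close> may have unbounded speed near its finitely many exceptional points, so
  integrability of the speed is asked for explicitly (\<open>has_integral\<close>); without it the value of
  \<open>integral\<close> would be \<open>0\<close>.\<close>

definition intrinsic_dist :: "'a::euclidean_space set \<Rightarrow> 'a \<Rightarrow> 'a \<Rightarrow> real" where
  "intrinsic_dist M x y =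
     (if x \<in> M \<and> y \<in> M then
        Inf {l. \<exists>g. valid_path g \<and> path_image g \<subseteq> M \<and> pathstart g = x \<and> pathfinish g = y \<and>
                ((\<lambda>t. norm (vector_derivative g (at t))) has_integral l) {0..1}}
      else 0)"

definition complete_submanifold :: "'a::euclidean_space set \<Rightarrow> bool" where
  "complete_submanifold M \<longleftrightarrow> Metric_space.mcomplete M (intrinsic_dist M)"


subsection \<open>Metric notions: Hausdorff dimension and tangent cones\<close>

text \<open>Metric spaces are given by a carrier and a distance function, as in the locale
  \<^locale>\<open>Metric_space\<close>.\<close>

definition set_diam :: "('a \<Rightarrow> 'a \<Rightarrow> real) \<Rightarrow> 'a set \<Rightarrow> real" where
  "set_diam d A = (if A = {} then 0 else SUP (x, y)\<in>A \<times> A. d x y)"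

definition hausdorff_premeasure ::
    "'a set \<Rightarrow> ('a \<Rightarrow> 'a \<Rightarrow> real) \<Rightarrow> real \<Rightarrow> real \<Rightarrow> ennreal" where
  "hausdorff_premeasure X d s \<delta> =
     Inf {(\<Sum>i. ennreal (set_diam d (A i) powr s)) | A :: nat \<Rightarrow> 'a set.
            (\<forall>i. A i \<subseteq> X \<and> (\<forall>x\<in>A i. \<forall>y\<in>A i. d x y \<le> \<delta>)) \<and> X \<subseteq> (\<Union>i. A i)}"

definition hausdorff_measure :: "'a set \<Rightarrow> ('a \<Rightarrow> 'a \<Rightarrow> real) \<Rightarrow> real \<Rightarrow> ennreal" where
  "hausdorff_measure X d s = (SUP \<delta>\<in>{0<..}. hausdorff_premeasure X d s \<delta>)"

text \<open>Only exponents \<open>s > 0\<close> are used, so that \<open>0 powr s = 0\<close> is the intended value.\<close>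

definition hausdorff_dim :: "'a set \<Rightarrow> ('a \<Rightarrow> 'a \<Rightarrow> real) \<Rightarrow> ennreal" where
  "hausdorff_dim X d = Inf {ennreal s | s. 0 < s \<and> hausdorff_measure X d s = 0}"

text \<open>Pointed Gromov--Hausdorff convergence of \<open>(X i, d i, p i)\<close> to \<open>(Y, e, q)\<close> along the
  filter \<open>\<F>\<close>, in the formulation of Burago, Burago and Ivanov (A Course in Metric Geometry,
  Def. 8.1.1).\<close>

definition pointed_GH_limit ::
    "('i \<Rightarrow> 'a set) \<Rightarrow> ('i \<Rightarrow> 'a \<Rightarrow> 'a \<Rightarrow> real) \<Rightarrow> ('i \<Rightarrow> 'a) \<Rightarrow>
     'b set \<Rightarrow> ('b \<Rightarrow> 'b \<Rightarrow> real) \<Rightarrow> 'b \<Rightarrow> 'i filter \<Rightarrow> bool" where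
  "pointed_GH_limit X d p Y e q \<F> \<longleftrightarrow>
     (\<forall>r>0. \<forall>\<epsilon>>0. eventually (\<lambda>i. \<exists>f.
        f ` Metric_space.mball (X i) (d i) (p i) r \<subseteq> Y \<and>
        f (p i) = q \<and>
        (\<forall>x\<in>Metric_space.mball (X i) (d i) (p i) r.
         \<forall>y\<in>Metric_space.mball (X i) (d i) (p i) r. \<bar>e (f x) (f y) - d i x y\<bar> < \<epsilon>) \<and>
        (\<forall>z\<in>Metric_space.mball Y e q (r - \<epsilon>).
         \<exists>x\<in>Metric_space.mball (X i) (d i) (p i) r. e z (f x) < \<epsilon>)) \<F>)"

text \<open>\<open>(Y, e)\<close> with apex \<open>q\<close> is (isometric to) the tangent cone of \<open>(X, d)\<close> at \<open>p\<close>: it is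
  the pointed limit of the rescaled spaces \<open>(X, c d, p)\<close> as \<open>c \<rightarrow> \<infinity>\<close>.\<close>

definition is_tangent_cone ::
    "'a set \<Rightarrow> ('a \<Rightarrow> 'a \<Rightarrow> real) \<Rightarrow> 'a \<Rightarrow> 'b set \<Rightarrow> ('b \<Rightarrow> 'b \<Rightarrow> real) \<Rightarrow> 'b \<Rightarrow> bool" where
  "is_tangent_cone X d p Y e q \<longleftrightarrow>
     pointed_GH_limit (\<lambda>_::real. X) (\<lambda>c x y. c * d x y) (\<lambda>_. p) Y e q at_top"

text \<open>The Euclidean metric on \<open>topspace (Euclidean_space k)\<close>, the sequences supported on
  \<open>{..<k}\<close>; here \<open>k\<close> can be a variable.\<close>

definition euclid_dist :: "nat \<Rightarrow> (nat \<Rightarrow> real) \<Rightarrow> (nat \<Rightarrow> real) \<Rightarrow> real" where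
  "euclid_dist k x y = L2_set (\<lambda>i. x i - y i) {..<k}"

definition regular_point :: "'a set \<Rightarrow> ('a \<Rightarrow> 'a \<Rightarrow> real) \<Rightarrow> 'a \<Rightarrow> bool" where
  "regular_point X d p \<longleftrightarrow>
     p \<in> X \<and>
     (\<exists>k. hausdorff_dim X d = of_nat k \<and>
          is_tangent_cone X d p (topspace (Euclidean_space k)) (euclid_dist k) (\<lambda>_. 0))"


subsection \<open>Equidistant foliations\<close>

definition equidistant_foliation :: "(real ^ 'n) set set \<Rightarrow> bool" where
  "equidistant_foliation \<F> \<longleftrightarrow>
     partition_on UNIV \<F> \<and>
     (\<forall>F\<in>\<F>. (\<exists>k. properly_embedded_submanifold k F) \<and> connected F \<and> complete_submanifold F) \<and>
     (\<forall>F\<in>\<F>. \<forall>G\<in>\<F>. \<forall>p\<in>F. \<forall>p'\<in>F. infdist p G = infdist p' G) \<and>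
     (\<forall>F\<in>\<F>. \<forall>p\<in>F. \<forall>v\<in>tangent_space F p.
        \<exists>U X. open U \<and> p \<in> U \<and> smooth_on X U \<and> X p = v \<and>
          (\<forall>G\<in>\<F>. \<forall>q\<in>U \<inter> G. X q \<in> tangent_space G q))"

text \<open>The leaf space is the carrier \<open>\<F>\<close> with the distance \<^const>\<open>setdist\<close>.\<close>

definition regular_leaf :: "(real ^ 'n) set set \<Rightarrow> (real ^ 'n) set \<Rightarrow> bool" where
  "regular_leaf \<F> F \<longleftrightarrow> regular_point \<F> setdist F"

definition full :: "(real ^ 'n) set \<Rightarrow> bool" where
  "full M \<longleftrightarrow> \<not> (\<exists>A. affine A \<and> A \<noteq> UNIV \<and> M \<subseteq> A)"

end

theory Submission
  imports Defs
begin

text \<open>The argument is metric. Let \<open>V\<close> be the affine hull of \<open>F\<close> and suppose that a leaf \<open>G\<close>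
  contains a point \<open>v \<in> V\<close> and a point \<open>q \<notin> V\<close>. Let \<open>w\<close> be the unit vector orthogonal to \<open>V\<close>
  pointing from \<open>V\<close> to \<open>q\<close>, let \<open>f\<close> be a point of \<open>F\<close> nearest to \<open>q\<close>, and let \<open>L\<^sub>t\<close> be the leaf
  through \<open>f + t w\<close>. As \<open>w\<close> is orthogonal to \<open>V\<close>, the leaf \<open>L\<^sub>t\<close> has distance \<open>\<bar>t\<bar>\<close> from \<open>F\<close>
  for every \<open>t\<close>: in the leaf space, \<open>t \<mapsto> L\<^sub>t\<close> and \<open>t \<mapsto> L\<^sub>-\<^sub>t\<close> (\<open>t \<ge> 0\<close>) are two
  rays issuing from \<open>F\<close>.

  Such a ray can be lifted from any \<open>x \<in> L\<^sub>t\<close>: if \<open>a\<close> is a point of \<open>F\<close> nearest to \<open>x\<close> and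
  \<open>y\<close> is the unit vector from \<open>a\<close> to \<open>x\<close>, then \<open>a + T y \<in> L\<^sub>T\<close> for all \<open>T \<ge> t\<close>. Hence no
  point \<open>p\<close> of \<open>F\<close> is closer than \<open>T\<close> to \<open>a + T y\<close>, and \<open>T \<rightarrow> \<infinity>\<close> gives
  \<open>(p - a) \<bullet> y \<le> 0\<close> (lemma \<open>foot_direction_inner_nonpos\<close>). Likewise \<open>(p - a) \<bullet> z \<le> 0\<close> for
  the unit vector \<open>z\<close> from \<open>a\<close> to a nearest point of \<open>L\<^sub>-\<^sub>t\<close>. Regularity of \<open>F\<close> enters here:
  in a Euclidean tangent cone the two rays have opposite directions, so the distance from
  \<open>L\<^sub>t\<close> to \<open>L\<^sub>-\<^sub>t\<close> is \<open>2 t - o(t)\<close> (lemma \<open>opposite_leaves_far\<close>), which makes \<open>y + z\<close> small.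
  The two inequalities then force \<open>(p - a) \<bullet> y \<rightarrow> 0\<close> as \<open>t \<rightarrow> 0\<close> for all \<open>p \<in> F\<close>. Since \<open>v\<close>
  is an affine combination of points of \<open>F\<close>, also \<open>(v - a) \<bullet> y \<rightarrow> 0\<close>.

  On the other hand \<open>v\<close> and \<open>q\<close> lie in the same leaf, so they have the same distance \<open>d\<close> from
  \<open>F\<close> and the same distance from \<open>L\<^sub>t\<close>. Moving from \<open>f\<close> to \<open>f + t w\<close> approaches \<open>q\<close>, whence
  \<open>dist(q, L\<^sub>t)\<^sup>2 \<le> d\<^sup>2 - 2 t dist(q, V) + t\<^sup>2\<close>. Applied to \<open>x\<close>, the point of \<open>L\<^sub>t\<close> nearest to
  \<open>v\<close>, this yields \<open>(v - a) \<bullet> y \<ge> dist(q, V) > 0\<close>, a contradiction.\<close>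

section \<open>Partitions into equidistant closed sets\<close>

locale equidistant_partition =
  fixes \<F> :: "'a::euclidean_space set set"
  assumes partition: "partition_on UNIV \<F>"
    and closed_leaf: "F \<in> \<F> \<Longrightarrow> closed F"
    and equidistant: "\<lbrakk>F \<in> \<F>; G \<in> \<F>; p \<in> F; p' \<in> F\<rbrakk> \<Longrightarrow> infdist p G = infdist p' G"
begin

definition leaf :: "'a \<Rightarrow> 'a set" where
  "leaf x = (THE G. G \<in> \<F> \<and> x \<in> G)"

lemma leaf_unique: "\<lbrakk>F \<in> \<F>; G \<in> \<F>; x \<in> F; x \<in> G\<rbrakk> \<Longrightarrow> F = G"
  using partition unfolding partition_on_def disjoint_def by blast

lemma leaf_eq: "\<lbrakk>G \<in> \<F>; x \<in> G\<rbrakk> \<Longrightarrow> leaf x = G"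
  unfolding leaf_def by (rule the_equality) (use leaf_unique in blast)+

lemma leaf_mem: "leaf x \<in> \<F>" and mem_leaf: "x \<in> leaf x"
proof -
  obtain G where "G \<in> \<F>" "x \<in> G"
    using partition unfolding partition_on_def by blast
  then show "leaf x \<in> \<F>" "x \<in> leaf x"
    using leaf_eq by auto
qed

lemma leaf_nonempty: "F \<in> \<F> \<Longrightarrow> F \<noteq> {}"
  using partition unfolding partition_on_def by blast

text \<open>Equidistance makes the infimum over one of the two arguments redundant. The leaf distance
  is therefore attained from every point of a leaf, and so inherits the triangle inequality,
  which fails for \<^const>\<open>setdist\<close> on arbitrary closed sets.\<close>

lemma setdist_leaf:
  assumes "F \<in> \<F>" "G \<in> \<F>" "p \<in> F"
  shows "setdist F G = infdist p G"
proof (rule antisym)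
  have "setdist F G \<le> setdist {p} G"
    using assms by (intro setdist_subset_left) auto
  then show "setdist F G \<le> infdist p G"
    by (simp add: infdist_eq_setdist)
  have "infdist p G \<le> dist x y" if "x \<in> F" "y \<in> G" for x y
    using equidistant[OF assms(1,2,3) that(1)] infdist_le[OF that(2), of x] by simp
  then show "infdist p G \<le> setdist F G"
    using assms leaf_nonempty by (intro le_setdistI) auto
qed

lemma nearest_in_leaf:
  assumes "G \<in> \<F>"
  obtains y where "y \<in> G" "dist x y = infdist x G"
  using infdist_attains_inf[OF closed_leaf[OF assms] leaf_nonempty[OF assms], of x]
  by metis

lemma setdist_attained:
  assumes "F \<in> \<F>" "G \<in> \<F>" "p \<in> F"
  obtains y where "y \<in> G" "dist p y = setdist F G"
  using nearest_in_leaf[OF assms(2), of p] setdist_leaf[OF assms] by metis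

lemma setdist_triangle_leaf:
  assumes "F \<in> \<F>" "G \<in> \<F>" "H \<in> \<F>"
  shows "setdist F H \<le> setdist F G + setdist G H"
proof -
  obtain p where p: "p \<in> F" using leaf_nonempty[OF assms(1)] by blast
  obtain y where y: "y \<in> G" "dist p y = setdist F G"
    using setdist_attained[OF assms(1,2) p] .
  obtain z where z: "z \<in> H" "dist y z = setdist G H"
    using setdist_attained[OF assms(2,3) y(1)] .
  have "setdist F H \<le> dist p z" using p z by (simp add: setdist_le_dist)
  also have "\<dots> \<le> dist p y + dist y z" by (rule dist_triangle)
  finally show ?thesis using y z by simp
qed

lemma Metric_space_leaves:
  assumes "0 < c"
  shows "Metric_space \<F> (\<lambda>F G. c * setdist F G)"
proof
  show "0 \<le> c * setdist F G" for F G
    using assms by (simp add: setdist_pos_le)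
  show "c * setdist F G = c * setdist G F" for F G
    by (simp add: setdist_sym)
  show "c * setdist F G = 0 \<longleftrightarrow> F = G" if FG: "F \<in> \<F>" "G \<in> \<F>" for F G
  proof
    assume "c * setdist F G = 0"
    then have 0: "setdist F G = 0" using assms by simp
    obtain p where p: "p \<in> F" using leaf_nonempty[OF FG(1)] by blast
    obtain y where "y \<in> G" "dist p y = setdist F G"
      using setdist_attained[OF FG p] .
    then show "F = G" using 0 p leaf_unique[OF FG] by auto
  next
    assume "F = G"
    then show "c * setdist F G = 0" by (simp add: setdist_refl)
  qed
  show "c * setdist F H \<le> c * setdist F G + c * setdist G H"
    if "F \<in> \<F>" "G \<in> \<F>" "H \<in> \<F>" for F G H
    using setdist_triangle_leaf[OF that] assms
    by (metis distrib_left mult_le_cancel_left_pos)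
qed

end

lemma parallelogram_identity:
  fixes x y :: "'a::real_inner"
  shows "(norm (x + y))\<^sup>2 = 2 * (norm x)\<^sup>2 + 2 * (norm y)\<^sup>2 - (norm (x - y))\<^sup>2"
  unfolding power2_norm_eq_inner
  by (simp add: inner_add_left inner_add_right inner_diff_left inner_diff_right)

section \<open>Euclidean tangent cones and antipodal leaves\<close>

lemma euclid_dist_triangle: "euclid_dist k x z \<le> euclid_dist k x y + euclid_dist k y z"
  using L2_set_triangle_ineq[of "\<lambda>i. x i - y i" "\<lambda>i. y i - z i" "{..<k}"]
  by (simp add: euclid_dist_def)

lemma euclid_dist_commute: "euclid_dist k x y = euclid_dist k y x"
  unfolding euclid_dist_def L2_set_def by (simp add: power2_commute)

lemma Metric_space_euclid:
  "Metric_space (topspace (Euclidean_space k)) (euclid_dist k)"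
proof
  show "0 \<le> euclid_dist k x y" for x y
    by (simp add: euclid_dist_def L2_set_nonneg)
  show "euclid_dist k x y = euclid_dist k y x" for x y
    by (rule euclid_dist_commute)
  show "euclid_dist k x y = 0 \<longleftrightarrow> x = y"
    if "x \<in> topspace (Euclidean_space k)" "y \<in> topspace (Euclidean_space k)" for x y
  proof -
    have "euclid_dist k x y = 0 \<longleftrightarrow> (\<forall>i<k. x i = y i)"
      by (auto simp: euclid_dist_def L2_set_eq_0_iff)
    also have "\<dots> \<longleftrightarrow> x = y"
      using that by (auto simp: topspace_Euclidean_space fun_eq_iff) (metis linorder_not_le)
    finally show ?thesis .
  qed
  show "euclid_dist k x z \<le> euclid_dist k x y + euclid_dist k y z" for x y z
    by (rule euclid_dist_triangle)
qed

lemma euclid_dist_antipode: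
  "euclid_dist k a (\<lambda>i. - a i) = 2 * euclid_dist k (\<lambda>_. 0) a"
  "euclid_dist k (\<lambda>_. 0) (\<lambda>i. - a i) = euclid_dist k (\<lambda>_. 0) a"
proof -
  have "(\<lambda>i. a i - - a i) = (\<lambda>i. 2 * a i)" by auto
  then show "euclid_dist k a (\<lambda>i. - a i) = 2 * euclid_dist k (\<lambda>_. 0) a"
    using L2_set_right_distrib[of 2 a "{..<k}"]
    unfolding euclid_dist_def by (simp add: L2_set_def)
  show "euclid_dist k (\<lambda>_. 0) (\<lambda>i. - a i) = euclid_dist k (\<lambda>_. 0) a"
    by (simp add: euclid_dist_def L2_set_def)
qed

context equidistant_partition
begin

text \<open>Transport of the antipode: a leaf \<open>L\<close> at distance \<open>s\<close> from \<open>F\<close> is sent to a point \<open>a\<close>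
  near the unit sphere by an almost-isometry of the leaf space, scaled by \<open>1 / s\<close>, into the
  tangent cone. The cone being Euclidean, it contains \<open>- a\<close>, and \<open>N\<close> is a leaf sent close to
  \<open>- a\<close>.\<close>

lemma tangent_cone_antipodal_leaf:
  assumes cone: "is_tangent_cone \<F> setdist F (topspace (Euclidean_space k)) (euclid_dist k) (\<lambda>_. 0)"
    and F: "F \<in> \<F>" and eps: "0 < \<epsilon>" "\<epsilon> < 1/2"
  shows "\<forall>\<^sub>F s in at_right 0. \<forall>L\<in>\<F>. setdist F L = s \<longrightarrow>
           (\<exists>N\<in>\<F>. setdist F N \<le> s * (1 + 3 * \<epsilon>) \<and> s * (2 - 4 * \<epsilon>) \<le> setdist L N)"
proof -
  let ?Y = "topspace (Euclidean_space k)" and ?e = "euclid_dist k" and ?o = "\<lambda>_::nat. 0::real"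
  \<comment> \<open>Radius \<open>2\<close> leaves room for the unit sphere and for the error \<open>\<epsilon> < 1/2\<close> in almost-surjectivity.\<close>
  let ?B = "\<lambda>c::real. Metric_space.mball \<F> (\<lambda>x y. c * setdist x y) F 2"
  have "\<forall>\<^sub>F c in at_top. \<exists>g. g ` ?B c \<subseteq> ?Y \<and> g F = ?o \<and>
      (\<forall>x\<in>?B c. \<forall>y\<in>?B c. \<bar>?e (g x) (g y) - c * setdist x y\<bar> < \<epsilon>) \<and>
      (\<forall>z\<in>Metric_space.mball ?Y ?e ?o (2 - \<epsilon>). \<exists>x\<in>?B c. ?e z (g x) < \<epsilon>)"
    by (rule cone[unfolded is_tangent_cone_def pointed_GH_limit_def, rule_format, OF _ eps(1)]) simp
  from eventually_compose_filterlim[OF this filterlim_inverse_at_top_right]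
    eventually_at_right_less[of 0]
  show ?thesis
  proof eventually_elim
    case (elim s)
    then have s: "0 < s" "0 < inverse s" by auto
    interpret B: Metric_space \<F> "\<lambda>x y. inverse s * setdist x y"
      by (rule Metric_space_leaves[OF s(2)])
    interpret Y: Metric_space ?Y ?e
      by (rule Metric_space_euclid)
    from elim obtain g where g: "g ` ?B (inverse s) \<subseteq> ?Y" "g F = ?o"
      and dist: "\<And>x y. \<lbrakk>x \<in> ?B (inverse s); y \<in> ?B (inverse s)\<rbrakk> \<Longrightarrow>
            \<bar>?e (g x) (g y) - inverse s * setdist x y\<bar> < \<epsilon>"
      and onto: "\<And>z. z \<in> Metric_space.mball ?Y ?e ?o (2 - \<epsilon>) \<Longrightarrow> \<exists>x\<in>?B (inverse s). ?e z (g x) < \<epsilon>"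
      by blast
    show ?case
    proof (intro ballI impI)
      fix L assume L: "L \<in> \<F>" "setdist F L = s"
      have FB: "F \<in> ?B (inverse s)" using F by simp
      have LB: "L \<in> ?B (inverse s)" using F L s by simp
      define a where "a = g L"
      have a: "\<bar>?e ?o a - 1\<bar> < \<epsilon>"
        using dist[OF FB LB] L s g(2) by (simp add: a_def)
      have aY: "a \<in> ?Y" using g(1) LB by (auto simp: a_def)
      have aY': "(\<lambda>i. - a i) \<in> ?Y" "?o \<in> ?Y"
        using aY by (simp_all add: topspace_Euclidean_space)
      then have "(\<lambda>i. - a i) \<in> Metric_space.mball ?Y ?e ?o (2 - \<epsilon>)"
        unfolding Y.in_mball using a eps by (simp add: euclid_dist_antipode)
      then obtain N where N: "N \<in> ?B (inverse s)" "?e (\<lambda>i. - a i) (g N) < \<epsilon>"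
        using onto by blast
      have "?e ?o (g N) < 1 + 2 * \<epsilon>"
        using euclid_dist_triangle[of k ?o "g N" "\<lambda>i. - a i"] N(2) a
        by (simp add: euclid_dist_antipode)
      then have 1: "inverse s * setdist F N \<le> 1 + 3 * \<epsilon>"
        using dist[OF FB N(1)] g(2) by simp
      have "2 - 3 * \<epsilon> \<le> ?e a (g N)"
        using euclid_dist_triangle[of k a "\<lambda>i. - a i" "g N"] N(2) a
          euclid_dist_commute[of k "\<lambda>i. - a i" "g N"]
        by (simp add: euclid_dist_antipode)
      then have 2: "2 - 4 * \<epsilon> \<le> inverse s * setdist L N"
        using dist[OF LB N(1)] by (simp add: a_def)
      show "\<exists>N\<in>\<F>. setdist F N \<le> s * (1 + 3 * \<epsilon>) \<and> s * (2 - 4 * \<epsilon>) \<le> setdist L N"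
      proof (intro bexI conjI)
        show "N \<in> \<F>" using N(1) by simp
        show "setdist F N \<le> s * (1 + 3 * \<epsilon>)" "s * (2 - 4 * \<epsilon>) \<le> setdist L N"
          using 1 2 s by (simp_all add: field_simps)
      qed
    qed
  qed
qed

text \<open>The leaf \<open>N\<close> antipodal to the leaf through \<open>f + s w\<close> contains some \<open>f + n\<close> with
  \<open>\<bar>n\<bar> \<lesssim> s\<close> and \<open>\<bar>s w - n\<bar> \<gtrsim> 2 s\<close>. In Euclidean space this forces \<open>n \<approx> - s w\<close>, so \<open>N\<close> is
  close to the leaf through \<open>f - s w\<close>.\<close>

lemma opposite_leaves_far:
  assumes cone: "is_tangent_cone \<F> setdist F (topspace (Euclidean_space k)) (euclid_dist k) (\<lambda>_. 0)"
    and F: "F \<in> \<F>" and f: "f \<in> F" and w: "norm w = 1"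
    and ray: "\<And>t. 0 \<le> t \<Longrightarrow> infdist (f + t *\<^sub>R w) F = t"
    and delta: "0 < \<delta>"
  shows "\<forall>\<^sub>F s in at_right 0. (2 - \<delta>) * s \<le> setdist (leaf (f + s *\<^sub>R w)) (leaf (f - s *\<^sub>R w))"
proof -
  \<comment> \<open>The parallelogram identity will bound \<open>\<bar>s w + n\<bar>\<^sup>2\<close> by \<open>30 \<epsilon> s\<^sup>2\<close>; half of \<open>\<delta>\<close> is spent on
    that term, half on the defect \<open>4 \<epsilon>\<close> of \<open>N\<close>.\<close>
  define \<epsilon> where "\<epsilon> = min (1/4) (min (\<delta> / 8) (\<delta>\<^sup>2 / 120))"
  have "\<epsilon> \<le> 1/4" "\<epsilon> \<le> \<delta> / 8" "\<epsilon> \<le> \<delta>\<^sup>2 / 120" by (auto simp: \<epsilon>_def)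
  moreover have "0 < \<epsilon>" using delta by (simp add: \<epsilon>_def)
  ultimately have eps: "0 < \<epsilon>" "\<epsilon> < 1/2" "\<epsilon> \<le> 1" "4 * \<epsilon> \<le> \<delta> / 2"
      "30 * \<epsilon> \<le> (\<delta> / 2)\<^sup>2"
    by (auto simp: power_divide)
  from tangent_cone_antipodal_leaf[OF cone F eps(1,2)] eventually_at_right_less[of 0]
  show ?thesis
  proof eventually_elim
    case (elim s)
    then have s: "0 < s" by simp
    let ?L = "leaf (f + s *\<^sub>R w)" and ?M = "leaf (f - s *\<^sub>R w)"
    have "setdist F ?L = s"
      using setdist_leaf[OF leaf_mem F mem_leaf] ray[of s] s by (metis less_imp_le setdist_sym)
    then obtain N where N: "N \<in> \<F>" "setdist F N \<le> s * (1 + 3 * \<epsilon>)" "s * (2 - 4 * \<epsilon>) \<le> setdist ?L N"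
      using elim leaf_mem by blast
    obtain x where x: "x \<in> N" "dist f x = setdist F N"
      using setdist_attained[OF F N(1) f] .
    define n where "n = x - f"
    have n: "norm n \<le> s * (1 + 3 * \<epsilon>)"
      using x N by (simp add: n_def dist_norm norm_minus_commute)
    have "s * (2 - 4 * \<epsilon>) \<le> dist (f + s *\<^sub>R w) x"
      using N(3) setdist_le_dist[OF mem_leaf x(1)] by (rule order_trans)
    also have "\<dots> = norm (s *\<^sub>R w - n)"
      by (simp add: dist_norm n_def algebra_simps)
    finally have far: "s * (2 - 4 * \<epsilon>) \<le> norm (s *\<^sub>R w - n)" .
    have par: "(norm (s *\<^sub>R w + n))\<^sup>2 = 2 * s\<^sup>2 + 2 * (norm n)\<^sup>2 - (norm (s *\<^sub>R w - n))\<^sup>2"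
      using parallelogram_identity[of "s *\<^sub>R w" n] w s by simp
    have "(norm n)\<^sup>2 \<le> (s * (1 + 3 * \<epsilon>))\<^sup>2" "(s * (2 - 4 * \<epsilon>))\<^sup>2 \<le> (norm (s *\<^sub>R w - n))\<^sup>2"
      using n far s eps by (intro power_mono; simp)+
    then have "(norm (s *\<^sub>R w + n))\<^sup>2 \<le> 2 * s\<^sup>2 + 2 * (s * (1 + 3 * \<epsilon>))\<^sup>2 - (s * (2 - 4 * \<epsilon>))\<^sup>2"
      unfolding par by linarith
    also have "\<dots> = s\<^sup>2 * (28 * \<epsilon> + 2 * \<epsilon> * \<epsilon>)"
      by (simp add: power2_eq_square algebra_simps)
    also have "\<dots> \<le> s\<^sup>2 * (\<delta> / 2)\<^sup>2"
    proof (rule mult_left_mono)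
      have "\<epsilon> * \<epsilon> \<le> 1 * \<epsilon>" using eps by (intro mult_right_mono) auto
      then show "28 * \<epsilon> + 2 * \<epsilon> * \<epsilon> \<le> (\<delta> / 2)\<^sup>2" using eps(5) by linarith
    qed simp
    finally have "(norm (s *\<^sub>R w + n))\<^sup>2 \<le> (s * (\<delta> / 2))\<^sup>2"
      by (simp only: power_mult_distrib)
    then have close: "norm (s *\<^sub>R w + n) \<le> s * (\<delta> / 2)"
      by (rule power2_le_imp_le) (use s delta in simp)
    have "setdist N ?M \<le> dist x (f - s *\<^sub>R w)"
      by (rule setdist_le_dist[OF x(1) mem_leaf])
    also have "\<dots> = norm (s *\<^sub>R w + n)"
      by (simp add: dist_norm n_def algebra_simps)
    finally have "setdist N ?M \<le> s * (\<delta> / 2)" using close by linarith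
    moreover have "setdist ?L N \<le> setdist ?L ?M + setdist N ?M"
      using setdist_triangle_leaf[OF leaf_mem leaf_mem N(1)] by (metis setdist_sym)
    moreover have "s * (4 * \<epsilon>) \<le> s * (\<delta> / 2)"
      using eps(4) s by (intro mult_left_mono) auto
    ultimately show ?case
      using N(3) by (simp add: algebra_simps)
  qed
qed

section \<open>Rays orthogonal to the affine hull\<close>

text \<open>The segment from \<open>f'\<close> to \<open>x\<close> extends to a ray that meets the leaf through \<open>f + T w\<close> at
  distance \<open>T\<close> from \<open>f'\<close>, for every \<open>T \<ge> t\<close>. So the open balls of radius \<open>T\<close> about the points of
  this ray miss \<open>F\<close>; as \<open>T\<close> grows they exhaust an open half-space bounded by the hyperplane
  through \<open>f'\<close> orthogonal to the ray, which thus misses \<open>F\<close> too.\<close>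

lemma foot_direction_inner_nonpos:
  assumes F: "F \<in> \<F>" and w: "norm w = 1"
    and ray: "\<And>t. 0 \<le> t \<Longrightarrow> infdist (f + t *\<^sub>R w) F = t"
    and t: "0 < t" and x: "x \<in> leaf (f + t *\<^sub>R w)"
    and f': "f' \<in> F" "dist x f' = t" and p: "p \<in> F"
  shows "(p - f') \<bullet> (x - f') \<le> 0"
proof (rule ccontr)
  define y where "y = (1 / t) *\<^sub>R (x - f')"
  have y1: "norm y = 1" using f' t by (simp add: y_def dist_norm)
  have x_eq: "x = f' + t *\<^sub>R y" using t by (simp add: y_def)
  have far: "T \<le> norm (f' + T *\<^sub>R y - p)" if "t \<le> T" for T
  proof -
    let ?L = "leaf (f + T *\<^sub>R w)"
    have dF: "T \<le> dist r z" if "r \<in> F" "z \<in> ?L" for r z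
      using infdist_le[OF that(1), of z] equidistant[OF leaf_mem F that(2) mem_leaf]
        ray[of T] t \<open>t \<le> T\<close> by (simp add: dist_commute)
    obtain z where z: "z \<in> ?L" "dist x z = infdist x ?L"
      using nearest_in_leaf[OF leaf_mem] .
    have "infdist x ?L = infdist (f + t *\<^sub>R w) ?L"
      by (rule equidistant[OF leaf_mem leaf_mem x mem_leaf])
    also have "\<dots> \<le> dist (f + t *\<^sub>R w) (f + T *\<^sub>R w)"
      by (rule infdist_le[OF mem_leaf])
    also have "\<dots> = norm ((t - T) *\<^sub>R w)"
      by (simp add: dist_norm scaleR_diff_left)
    also have "\<dots> = T - t" using w that by simp
    finally have xz: "dist x z \<le> T - t" using z by simp
    \<comment> \<open>The path from \<open>f'\<close> via \<open>x\<close> to \<open>z\<close> is as short as the distance between the leaves allows,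
      hence straight.\<close>
    have "dist f' z \<le> dist f' x + dist x z" by (rule dist_triangle)
    with dF[OF f'(1) z(1)] xz f'(2) have eq: "dist f' z = T" "dist x z = T - t"
      by (auto simp: dist_commute)
    then have "norm ((x - f') + (z - x)) = norm (x - f') + norm (z - x)"
      using f'(2) by (simp add: dist_norm norm_minus_commute)
    then have "norm (x - f') *\<^sub>R (z - x) = norm (z - x) *\<^sub>R (x - f')"
      by (simp only: norm_triangle_eq)
    then have "t *\<^sub>R (z - x) = (T - t) *\<^sub>R (t *\<^sub>R y)"
      using f'(2) eq(2) by (simp add: dist_norm norm_minus_commute x_eq)
    then have "t *\<^sub>R (z - x) = t *\<^sub>R ((T - t) *\<^sub>R y)" by (simp add: mult.commute)
    then have "z - x = (T - t) *\<^sub>R y" using t by (simp del: scaleR_scaleR)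
    then have "z = f' + T *\<^sub>R y" by (simp add: x_eq algebra_simps)
    then show ?thesis using dF[OF p z(1)] by (simp add: dist_norm norm_minus_commute)
  qed
  have bound: "2 * T * ((p - f') \<bullet> y) \<le> (norm (p - f'))\<^sup>2" if "t \<le> T" for T
  proof -
    have "T\<^sup>2 \<le> (norm (f' + T *\<^sub>R y - p))\<^sup>2"
      using far[OF that] t that by (intro power_mono) auto
    also have "\<dots> = (norm (T *\<^sub>R y - (p - f')))\<^sup>2" by (simp add: algebra_simps)
    also have "\<dots> = T\<^sup>2 * (norm y)\<^sup>2 - 2 * T * ((p - f') \<bullet> y) + (norm (p - f'))\<^sup>2"
      unfolding power2_norm_eq_inner
      by (simp add: inner_diff_left inner_diff_right inner_commute power2_eq_square algebra_simps)
    finally show ?thesis using y1 by simp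
  qed
  assume "\<not> (p - f') \<bullet> (x - f') \<le> 0"
  then have pos: "0 < (p - f') \<bullet> y" using t by (simp add: y_def)
  define T where "T = t + (norm (p - f'))\<^sup>2 / ((p - f') \<bullet> y)"
  have T: "t \<le> T" using pos by (simp add: T_def)
  have "T * ((p - f') \<bullet> y) = t * ((p - f') \<bullet> y) + (norm (p - f'))\<^sup>2"
    using pos by (simp add: T_def distrib_right)
  moreover have "0 < t * ((p - f') \<bullet> y)" using pos t by simp
  moreover have "2 * (T * ((p - f') \<bullet> y)) \<le> (norm (p - f'))\<^sup>2"
    using bound[OF T] by (simp only: mult.assoc)
  moreover have "0 \<le> (norm (p - f'))\<^sup>2" by simp
  ultimately show False by linarith
qed

end

text \<open>Coefficients of an affine combination can be negative, so only two-sided bounds pass from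
  \<open>S\<close> to its affine hull. The constant \<open>K\<close> is uniform in the base point \<open>a\<close> because, in the
  application, \<open>a\<close> moves as \<open>t \<rightarrow> 0\<close>.\<close>

lemma affine_hull_inner_bound:
  fixes v :: "'a::euclidean_space"
  assumes "v \<in> affine hull S"
  obtains K where "0 \<le> K"
    "\<And>a y \<eta>. \<lbrakk>0 \<le> \<eta>; \<And>p. p \<in> S \<Longrightarrow> \<bar>(p - a) \<bullet> y\<bar> \<le> \<eta> * norm (p - a)\<rbrakk>
        \<Longrightarrow> (v - a) \<bullet> y \<le> \<eta> * (K * (1 + norm (v - a)))"
proof -
  obtain T c where T: "finite T" "T \<subseteq> S" "sum c T = 1" "(\<Sum>p\<in>T. c p *\<^sub>R p) = v"
    using assms unfolding affine_hull_explicit by blast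
  define K where "K = (\<Sum>p\<in>T. \<bar>c p\<bar> * (1 + norm (p - v)))"
  have "0 \<le> K" unfolding K_def by (intro sum_nonneg) simp
  moreover have "(v - a) \<bullet> y \<le> \<eta> * (K * (1 + norm (v - a)))"
    if eta: "0 \<le> \<eta>" and S: "\<And>p. p \<in> S \<Longrightarrow> \<bar>(p - a) \<bullet> y\<bar> \<le> \<eta> * norm (p - a)" for a y \<eta>
  proof -
    have "(\<Sum>p\<in>T. c p *\<^sub>R (p - a)) = (\<Sum>p\<in>T. c p *\<^sub>R p) - sum c T *\<^sub>R a"
      by (simp add: scaleR_diff_right sum_subtractf scaleR_left.sum)
    then have "(v - a) \<bullet> y = (\<Sum>p\<in>T. c p * ((p - a) \<bullet> y))"
      using T unfolding inner_scaleR_left[symmetric] inner_sum_left[symmetric] by simp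
    also have "\<dots> \<le> (\<Sum>p\<in>T. \<eta> * (\<bar>c p\<bar> * (1 + norm (p - v)) * (1 + norm (v - a))))"
    proof (rule sum_mono)
      fix p assume "p \<in> T"
      then have "\<bar>c p\<bar> * \<bar>(p - a) \<bullet> y\<bar> \<le> \<bar>c p\<bar> * (\<eta> * norm (p - a))"
        using S[of p] T(2) by (intro mult_left_mono) auto
      then have "c p * ((p - a) \<bullet> y) \<le> \<bar>c p\<bar> * (\<eta> * norm (p - a))"
        using abs_ge_self[of "c p * ((p - a) \<bullet> y)"] unfolding abs_mult by linarith
      also have "\<dots> \<le> \<bar>c p\<bar> * (\<eta> * ((1 + norm (p - v)) * (1 + norm (v - a))))"
      proof (intro mult_left_mono)
        have "(1 + norm (p - v)) * (1 + norm (v - a))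
            = 1 + norm (p - v) + norm (v - a) + norm (p - v) * norm (v - a)"
          by (simp add: algebra_simps)
        moreover have "norm (p - a) \<le> norm (p - v) + norm (v - a)"
          using norm_triangle_ineq[of "p - v" "v - a"] by simp
        moreover have "0 \<le> norm (p - v) * norm (v - a)" by simp
        ultimately show "norm (p - a) \<le> (1 + norm (p - v)) * (1 + norm (v - a))" by linarith
      qed (use eta in auto)
      finally show "c p * ((p - a) \<bullet> y) \<le> \<eta> * (\<bar>c p\<bar> * (1 + norm (p - v)) * (1 + norm (v - a)))"
        by (simp only: mult_ac)
    qed
    also have "\<dots> = \<eta> * (K * (1 + norm (v - a)))"
      by (simp add: K_def sum_distrib_left sum_distrib_right mult.assoc)
    finally show ?thesis .
  qed
  ultimately show ?thesis by (rule that)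
qed

lemma closest_point_affine_orthogonal:
  fixes q :: "'a::euclidean_space"
  assumes "affine V" "V \<noteq> {}" "x \<in> V"
  shows "(q - closest_point V q) \<bullet> (x - closest_point V q) = 0"
proof -
  let ?c = "closest_point V q"
  have V: "closed V" "convex V" using assms by (auto intro: affine_closed affine_imp_convex)
  have c: "?c \<in> V" using V assms by (simp add: closest_point_in_set)
  \<comment> \<open>The variational inequality for \<open>x\<close> and for its reflection in \<open>?c\<close> give both signs.\<close>
  have "2 *\<^sub>R ?c - x \<in> V"
    using mem_affine[OF assms(1) c assms(3), of 2 "-1"] by simp
  then have "(q - ?c) \<bullet> (2 *\<^sub>R ?c - x - ?c) \<le> 0"
    by (rule closest_point_dot[OF V(2,1)])
  moreover have "2 *\<^sub>R ?c - x - ?c = - (x - ?c)" by (simp add: scaleR_2)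
  ultimately have "0 \<le> (q - ?c) \<bullet> (x - ?c)" by (simp only: inner_minus_right)
  with closest_point_dot[OF V(2,1) assms(3), of q] show ?thesis by (rule antisym)
qed

section \<open>Saturation of the affine hull\<close>

context equidistant_partition
begin

text \<open>Two estimates for \<open>(v - a) \<bullet> y\<close> collide, where \<open>a + t y\<close> is the point nearest to \<open>v\<close> of
  the leaf through \<open>f + t w\<close> and \<open>a\<close> is its foot in \<open>F\<close>: regularity makes it small, and equidistance
  of \<open>v\<close> and \<open>q\<close> bounds it below by the distance of \<open>q\<close> from the affine hull.\<close>

theorem affine_hull_saturated:
  assumes cone: "is_tangent_cone \<F> setdist F (topspace (Euclidean_space k)) (euclid_dist k) (\<lambda>_. 0)"
    and F: "F \<in> \<F>" and G: "G \<in> \<F>" and v: "v \<in> G" "v \<in> affine hull F"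
  shows "G \<subseteq> affine hull F"
proof (rule ccontr)
  let ?V = "affine hull F"
  assume "\<not> G \<subseteq> ?V"
  then obtain q where q: "q \<in> G" "q \<notin> ?V" by blast
  define c where "c = closest_point ?V q"
  define u where "u = q - c"
  define w where "w = (1 / norm u) *\<^sub>R u"
  have V: "affine ?V" "?V \<noteq> {}" "closed ?V"
    using v by auto
  have cV: "c \<in> ?V" using V by (simp add: c_def closest_point_in_set)
  then have u: "0 < norm u" using q by (auto simp: u_def)
  then have w: "norm w = 1" by (simp add: w_def)
  have FV: "p \<in> ?V" if "p \<in> F" for p using that by (rule hull_inc)
  have orth: "w \<bullet> (x - x') = 0" if "x \<in> ?V" "x' \<in> ?V" for x x'
    using closest_point_affine_orthogonal[OF V(1,2) that(1), of q]
      closest_point_affine_orthogonal[OF V(1,2) that(2), of q]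
    by (simp add: w_def u_def c_def inner_diff_right)
  obtain f where f: "f \<in> F" "dist q f = infdist q F"
    using nearest_in_leaf[OF F] .
  have ray: "infdist (f + t *\<^sub>R z) F = t" if t: "0 \<le> t" and z: "z = w \<or> z = - w" for t z
  proof (rule antisym)
    show "infdist (f + t *\<^sub>R z) F \<le> t"
      using infdist_le[OF f(1), of "f + t *\<^sub>R z"] w z t by (auto simp: dist_norm)
    show "t \<le> infdist (f + t *\<^sub>R z) F"
      unfolding infdist_notempty[OF leaf_nonempty[OF F]]
    proof (rule cINF_greatest[OF leaf_nonempty[OF F]])
      fix p assume p: "p \<in> F"
      have "z \<bullet> (f - p) = 0" using orth[OF FV[OF f(1)] FV[OF p]] z by auto
      then have "z \<bullet> (f + t *\<^sub>R z - p) = t * (z \<bullet> z)"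
        by (simp add: inner_diff_right inner_add_right)
      also have "\<dots> = t" using w z by (auto simp: norm_eq_1)
      finally have "t \<le> norm z * norm (f + t *\<^sub>R z - p)"
        using norm_cauchy_schwarz[of z "f + t *\<^sub>R z - p"] by simp
      then show "t \<le> dist (f + t *\<^sub>R z) p" using w z by (auto simp: dist_norm)
    qed
  qed
  define d where "d = infdist q F"
  have dv: "d \<le> dist v p" if "p \<in> F" for p
    using equidistant[OF G F q(1) v(1)] infdist_le[OF that, of v] by (simp add: d_def)
  obtain K where K: "0 \<le> K"
    "\<And>a y \<eta>. \<lbrakk>0 \<le> \<eta>; \<And>p. p \<in> F \<Longrightarrow> \<bar>(p - a) \<bullet> y\<bar> \<le> \<eta> * norm (p - a)\<rbrakk>
        \<Longrightarrow> (v - a) \<bullet> y \<le> \<eta> * (K * (1 + norm (v - a)))"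
    using affine_hull_inner_bound[OF v(2)] by metis
  have d0: "0 \<le> d" by (simp add: d_def infdist_nonneg)
  \<comment> \<open>Below, \<open>\<bar>v - a\<bar> \<le> d + 2\<close> for \<open>t < 1\<close>, so an error \<open>\<eta>\<close> at the points of \<open>F\<close> becomes at most
    \<open>\<eta> K (d + 3) < \<bar>u\<bar>\<close> at \<open>v\<close>.\<close>
  define C where "C = K * (d + 3) + 1"
  define \<eta> where "\<eta> = norm u / C"
  have C: "0 < C" using K(1) d0 by (simp add: C_def add_nonneg_pos)
  have eta: "0 < \<eta>" using u C by (simp add: \<eta>_def)
  \<comment> \<open>For unit vectors, \<open>\<bar>y - z\<bar> \<ge> 2 - \<eta>\<^sup>2 / 4\<close> gives \<open>\<bar>y + z\<bar> \<le> \<eta>\<close>.\<close>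
  have "\<forall>\<^sub>F s in at_right 0. (2 - \<eta>\<^sup>2 / 4) * s \<le> setdist (leaf (f + s *\<^sub>R w)) (leaf (f - s *\<^sub>R w))"
    using eta by (intro opposite_leaves_far[OF cone F f(1) w]) (auto intro: ray)
  moreover have "\<forall>\<^sub>F s in at_right 0. s < (1::real)"
    by (rule order_tendstoD(2)[OF tendsto_ident_at]) simp
  ultimately have "\<forall>\<^sub>F s in at_right 0. 0 < s \<and> s < 1 \<and>
     (2 - \<eta>\<^sup>2 / 4) * s \<le> setdist (leaf (f + s *\<^sub>R w)) (leaf (f - s *\<^sub>R w))"
    using eventually_at_right_less[of "0::real"] by eventually_elim auto
  then obtain t where t: "0 < t" "t < 1"
    and opp: "(2 - \<eta>\<^sup>2 / 4) * t \<le> setdist (leaf (f + t *\<^sub>R w)) (leaf (f - t *\<^sub>R w))"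
    using eventually_happens[of _ "at_right (0::real)"] trivial_limit_at_right_real by blast
  let ?L = "leaf (f + t *\<^sub>R w)" and ?M = "leaf (f + t *\<^sub>R (- w))"
  obtain x where x: "x \<in> ?L" "dist v x = infdist v ?L"
    using nearest_in_leaf[OF leaf_mem] .
  obtain a where a: "a \<in> F" "dist x a = infdist x F"
    using nearest_in_leaf[OF F] .
  have xa: "dist x a = t"
    using a(2) equidistant[OF leaf_mem F x(1) mem_leaf] ray[of t w] t by simp
  obtain x' where x': "x' \<in> ?M" "dist a x' = setdist F ?M"
    using setdist_attained[OF F leaf_mem a(1)] .
  have "setdist F ?M = t"
    using setdist_leaf[OF leaf_mem F mem_leaf] ray[of t "- w"] t by (metis less_imp_le setdist_sym)
  then have x'a: "dist x' a = t" using x'(2) by (simp add: dist_commute)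
  define y where "y = (1 / t) *\<^sub>R (x - a)"
  define z where "z = (1 / t) *\<^sub>R (x' - a)"
  have x_eq: "x = a + t *\<^sub>R y" and x'_eq: "x' = a + t *\<^sub>R z" using t by (auto simp: y_def z_def)
  have yz1: "norm y = 1" "norm z = 1" using xa x'a t by (auto simp: y_def z_def dist_norm)
  have nonpos: "(p - a) \<bullet> y \<le> 0" "(p - a) \<bullet> z \<le> 0" if "p \<in> F" for p
  proof -
    have "(p - a) \<bullet> (x - a) \<le> 0"
      by (rule foot_direction_inner_nonpos[OF F w _ t(1) x(1) a(1) xa that]) (simp add: ray)
    then show "(p - a) \<bullet> y \<le> 0" using t by (simp add: y_def divide_le_0_iff)
    have "(p - a) \<bullet> (x' - a) \<le> 0"
      by (rule foot_direction_inner_nonpos[OF F _ _ t(1) x'(1) a(1) x'a that])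
        (use ray w in \<open>auto simp del: scaleR_minus_right\<close>)
    then show "(p - a) \<bullet> z \<le> 0" using t by (simp add: z_def divide_le_0_iff)
  qed
  have "(2 - \<eta>\<^sup>2 / 4) * t \<le> dist x x'"
    using opp setdist_le_dist[OF x(1) x'(1)] by simp
  also have "\<dots> = t * norm (y - z)"
    using t by (simp add: x_eq x'_eq dist_norm flip: scaleR_diff_right)
  finally have yz: "2 - \<eta>\<^sup>2 / 4 \<le> norm (y - z)" using t by (simp add: mult.commute)
  have "(norm (y + z))\<^sup>2 = 4 - (norm (y - z))\<^sup>2"
    using parallelogram_identity[of y z] yz1 by simp
  also have "\<dots> = (2 - norm (y - z)) * (2 + norm (y - z))"
    by (simp add: power2_eq_square algebra_simps)
  also have "\<dots> \<le> (\<eta>\<^sup>2 / 4) * 4"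
    using yz norm_triangle_ineq4[of y z] yz1 by (intro mult_mono) auto
  finally have "(norm (y + z))\<^sup>2 \<le> \<eta>\<^sup>2" by simp
  then have sum_small: "norm (y + z) \<le> \<eta>"
    by (rule power2_le_imp_le) (use eta in simp)
  \<comment> \<open>Both inner products are nonpositive and their sum is small, so each of them is small.\<close>
  have small: "\<bar>(p - a) \<bullet> y\<bar> \<le> \<eta> * norm (p - a)" if "p \<in> F" for p
  proof -
    have "- ((p - a) \<bullet> (y + z)) \<le> norm (p - a) * norm (y + z)"
      using Cauchy_Schwarz_ineq2[of "p - a" "y + z"] by linarith
    also have "\<dots> \<le> norm (p - a) * \<eta>" using sum_small by (intro mult_left_mono) auto
    finally show ?thesis using nonpos[OF that] by (simp add: inner_add_right mult.commute)
  qed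
  have "infdist v ?L \<le> dist q (f + t *\<^sub>R w)"
    using equidistant[OF G leaf_mem v(1) q(1)] infdist_le[OF mem_leaf] by metis
  then have vx: "dist v x \<le> dist q (f + t *\<^sub>R w)" using x(2) by simp
  have "dist v a \<le> dist v x + dist x a" by (rule dist_triangle)
  also have "\<dots> \<le> dist q f + dist f (f + t *\<^sub>R w) + t"
    using vx dist_triangle[of q "f + t *\<^sub>R w" f] xa by simp
  also have "\<dots> \<le> d + 2" using f(2) t w by (simp add: d_def dist_norm)
  finally have va: "norm (v - a) \<le> d + 2" by (simp add: dist_norm)
  have "(v - a) \<bullet> y \<le> \<eta> * (K * (1 + norm (v - a)))"
    using small eta by (intro K(2)) auto
  also have "\<dots> \<le> \<eta> * (K * (d + 3))"
    using va eta K(1) by (intro mult_left_mono) auto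
  also have "\<dots> < \<eta> * C" using eta by (simp add: C_def)
  also have "\<dots> = norm u" using C by (simp add: \<eta>_def)
  finally have upper: "(v - a) \<bullet> y < norm u" .
  have "(q - f) \<bullet> w = u \<bullet> w + w \<bullet> (c - f)"
    by (simp add: u_def inner_diff_left inner_diff_right inner_commute)
  also have "\<dots> = norm u"
    using orth[OF cV FV[OF f(1)]] u by (simp add: w_def power2_eq_square flip: power2_norm_eq_inner)
  finally have qf: "(q - f) \<bullet> w = norm u" .
  have expand: "(dist b (b' + t *\<^sub>R y))\<^sup>2 = (dist b b')\<^sup>2 - 2 * t * ((b - b') \<bullet> y) + t\<^sup>2"
    if "norm y = 1" for b b' y :: 'a
  proof -
    have "(dist b (b' + t *\<^sub>R y))\<^sup>2 = (norm ((b - b') - t *\<^sub>R y))\<^sup>2"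
      by (simp add: dist_norm algebra_simps)
    also have "\<dots> = (norm (b - b'))\<^sup>2 - 2 * t * ((b - b') \<bullet> y) + t\<^sup>2 * (norm y)\<^sup>2"
      unfolding power2_norm_eq_inner
      by (simp add: inner_diff_left inner_diff_right inner_commute power2_eq_square algebra_simps)
    finally show ?thesis using that by (simp add: dist_norm)
  qed
  have "d\<^sup>2 \<le> (dist v a)\<^sup>2" using dv[OF a(1)] d0 by (intro power_mono)
  moreover have "(dist v x)\<^sup>2 \<le> (dist q (f + t *\<^sub>R w))\<^sup>2" using vx by (intro power_mono) auto
  ultimately have "2 * t * norm u \<le> 2 * t * ((v - a) \<bullet> y)"
    using expand[OF yz1(1), of v a] expand[OF w, of q f] qf f(2) by (simp add: x_eq d_def)
  then show False using upper t by simp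
qed

end

lemma properly_embedded_imp_closed:
  assumes "properly_embedded_submanifold k M"
  shows "closed M"
proof -
  have "closed_map (top_of_set M) euclidean (\<lambda>x. x)"
    using assms unfolding properly_embedded_submanifold_def by (blast intro: proper_imp_closed_map)
  then have "closedin euclidean ((\<lambda>x. x) ` M)"
    unfolding closed_map_def by (metis closedin_topspace topspace_euclidean_subtopology)
  then show ?thesis by simp
qed

theorem proposition4p1:
  fixes \<F> :: "(real ^ 'n) set set" and F :: "(real ^ 'n) set"
  assumes "equidistant_foliation \<F>"
    and "F \<in> \<F>" and "regular_leaf \<F> F"
    and "\<not> full F"
  shows "\<forall>G\<in>\<F>. G \<inter> affine hull F \<noteq> {} \<longrightarrow> G \<subseteq> affine hull F"
proof -
  have part: "partition_on UNIV \<F>"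
    using assms(1) unfolding equidistant_foliation_def by (rule conjunct1)
  have embedded: "\<exists>k. properly_embedded_submanifold k F" if "F \<in> \<F>" for F
    using assms(1)[unfolded equidistant_foliation_def, THEN conjunct2, THEN conjunct1, rule_format, OF that]
    by (rule conjunct1)
  note equi = assms(1)[unfolded equidistant_foliation_def, THEN conjunct2, THEN conjunct2,
      THEN conjunct1, rule_format]
  interpret equidistant_partition \<F>
  proof
    show "partition_on UNIV \<F>"
      by (rule part)
    show "closed F" if "F \<in> \<F>" for F
      using embedded[OF that] properly_embedded_imp_closed by blast
    show "infdist p G = infdist p' G" if "F \<in> \<F>" "G \<in> \<F>" "p \<in> F" "p' \<in> F" for F G p p'
      by (rule equi[OF that])
  qed
  obtain k where "is_tangent_cone \<F> setdist F (topspace (Euclidean_space k)) (euclid_dist k) (\<lambda>_. 0)"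
    using assms(3) unfolding regular_leaf_def regular_point_def by blast
  then show ?thesis using affine_hull_saturated assms(2) by blast
qed

end
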